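(* Let $T^2=\{(z,w)\}$ act on $S^5\times S^3=\{(a,b)\in\mathbb{C}^3\times\mathbb{C}^2:|a|=|b|=1\}$ by $$(z,w)\ast(a,b)=(z^{m_1}a_1,\ z^{m_2}w^{n_2}a_2,\ z^{m_3}w^{n_3}a_3,\ w^{l_1}b_1,\ z^{k_2}w^{l_2}b_2),$$ where all exponents are integers, $\gcd(m_1,m_2,m_3,k_2)=\gcd(n_2,n_3,l_1,l_2)=1$, and all of $m_1,m_2,m_3,l_1,l_2,k_2$ are non-negative. Such an action is effectively free if and only if $m_1=m_2=m_3=l_1=l_2=1$ and, up to interchanging $n_2$ and $n_3$, $$(n_2,n_3,k_2)\in\{(0,0,k_2),\ (n_2,n_3,0),\ (1,1,2),\ (2,2,1),\ (0,2,1),\ (0,1,2)\}.$$ (Here $(0,0,k_2)$ and $(n_2,n_3,0)$ denote families with arbitrary $k_2$, respectively arbitrary $n_2,n_3$.) Further, such an action is effectively free if and only if it is free.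
   Context: $T^2$ is the torus of pairs $(z,w)$ of unit complex numbers. An action of a group on a set is effectively free if whenever a group element fixes some point, it fixes all points; it is free if only the identity element fixes some point. *)

theory Defs
  imports "HOL-Analysis.Analysis" "HOL-Algebra.Group_Action"
begin

definition effectively_free_action :: "('g, 'c) monoid_scheme \<Rightarrow> 'x set \<Rightarrow> ('g \<Rightarrow> 'x \<Rightarrow> 'x) \<Rightarrow> bool" where
  "effectively_free_action G E \<phi> \<longleftrightarrow>
     (\<forall>g\<in>carrier G. (\<exists>x\<in>E. \<phi> g x = x) \<longrightarrow> (\<forall>x\<in>E. \<phi> g x = x))"

definition free_action :: "('g, 'c) monoid_scheme \<Rightarrow> 'x set \<Rightarrow> ('g \<Rightarrow> 'x \<Rightarrow> 'x) \<Rightarrow> bool" where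
  "free_action G E \<phi> \<longleftrightarrow>
     (\<forall>g\<in>carrier G. (\<exists>x\<in>E. \<phi> g x = x) \<longrightarrow> g = \<one>\<^bsub>G\<^esub>)"

definition circle_group :: "complex monoid" where
  "circle_group = \<lparr>carrier = {z. norm z = 1}, mult = (*), one = 1\<rparr>"

definition T2 :: "(complex \<times> complex) monoid" where
  "T2 = circle_group \<times>\<times> circle_group"

definition S5_S3 :: "((complex^3) \<times> (complex^2)) set" where
  "S5_S3 = {(a, b). norm a = 1 \<and> norm b = 1}"

text \<open>
  The map is restricted to \<open>S5_S3\<close> because \<^locale>\<open>group_action\<close> requires
  extensional bijections; see \<open>group_action_torus_action\<close> below.
\<close>

definition torus_action ::
  "int \<Rightarrow> int \<Rightarrow> int \<Rightarrow> int \<Rightarrow> int \<Rightarrow> int \<Rightarrow> int \<Rightarrow> int \<Rightarrow>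
   complex \<times> complex \<Rightarrow> (complex^3) \<times> (complex^2) \<Rightarrow> (complex^3) \<times> (complex^2)" where
  "torus_action m1 m2 m3 n2 n3 k2 l1 l2 = (\<lambda>(z, w). \<lambda>(a, b)\<in>S5_S3.
     (vector [z powi m1 * a$1,
              z powi m2 * w powi n2 * a$2,
              z powi m3 * w powi n3 * a$3],
      vector [w powi l1 * b$1,
              z powi k2 * w powi l2 * b$2]))"

lemma group_circle_group: "group circle_group"
proof (rule groupI)
  fix x assume "x \<in> carrier circle_group"
  then show "\<exists>y\<in>carrier circle_group. y \<otimes>\<^bsub>circle_group\<^esub> x = \<one>\<^bsub>circle_group\<^esub>"
    by (intro bexI[of _ "inverse x"]) (auto simp: circle_group_def norm_inverse intro!: left_inverse)
qed (auto simp: circle_group_def norm_mult)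

lemma group_T2: "group T2"
  unfolding T2_def by (intro DirProd_group group_circle_group)

lemma carrier_T2: "carrier T2 = {(z, w). norm z = 1 \<and> norm w = 1}"
  by (auto simp: T2_def circle_group_def)

lemma torus_action_in_S5_S3:
  assumes "g \<in> carrier T2" "x \<in> S5_S3"
  shows "torus_action m1 m2 m3 n2 n3 k2 l1 l2 g x \<in> S5_S3"
  using assms
  by (auto simp: torus_action_def S5_S3_def carrier_T2 norm_vec_def L2_set_def
      sum_2 sum_3 norm_mult norm_power_int)

lemma torus_action_mult:
  assumes "g \<in> carrier T2" "h \<in> carrier T2" "x \<in> S5_S3"
  shows "torus_action m1 m2 m3 n2 n3 k2 l1 l2 (g \<otimes>\<^bsub>T2\<^esub> h) x =
    torus_action m1 m2 m3 n2 n3 k2 l1 l2 g (torus_action m1 m2 m3 n2 n3 k2 l1 l2 h x)"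
proof -
  obtain z w where g: "g = (z, w)" by (cases g)
  obtain z' w' where h: "h = (z', w')" by (cases h)
  obtain a b where x: "x = (a, b)" by (cases x)
  have "torus_action m1 m2 m3 n2 n3 k2 l1 l2 h x \<in> S5_S3"
    using torus_action_in_S5_S3 assms by blast
  then show ?thesis
    using assms(3)
    by (simp add: torus_action_def T2_def circle_group_def g h x power_int_mult_distrib mult_ac)
qed

lemma torus_action_one:
  assumes "x \<in> S5_S3"
  shows "torus_action m1 m2 m3 n2 n3 k2 l1 l2 \<one>\<^bsub>T2\<^esub> x = x"
  using assms
  by (cases x) (simp add: torus_action_def T2_def circle_group_def vec_eq_iff forall_3 forall_2)

lemma group_action_torus_action:
  "group_action T2 S5_S3 (torus_action m1 m2 m3 n2 n3 k2 l1 l2)"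
proof -
  let ?f = "torus_action m1 m2 m3 n2 n3 k2 l1 l2"
  interpret T: group T2 by (rule group_T2)
  have bij: "?f g \<in> Bij S5_S3" if g: "g \<in> carrier T2" for g
  proof -
    have "bij_betw (?f g) S5_S3 S5_S3"
    proof (rule bij_betw_byWitness[where f' = "?f (inv\<^bsub>T2\<^esub> g)"])
      show "\<forall>a\<in>S5_S3. ?f (inv\<^bsub>T2\<^esub> g) (?f g a) = a"
        using g by (simp flip: torus_action_mult add: torus_action_one)
      show "\<forall>a\<in>S5_S3. ?f g (?f (inv\<^bsub>T2\<^esub> g) a) = a"
        using g by (simp flip: torus_action_mult add: torus_action_one)
    qed (use g torus_action_in_S5_S3 in \<open>simp_all add: image_subset_iff\<close>)
    moreover have "?f g \<in> extensional S5_S3"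
      by (cases g) (simp add: torus_action_def)
    ultimately show ?thesis by (simp add: Bij_def)
  qed
  have "?f \<in> hom T2 (BijGroup S5_S3)"
  proof (rule homI)
    fix g h assume gh: "g \<in> carrier T2" "h \<in> carrier T2"
    have "?f (g \<otimes>\<^bsub>T2\<^esub> h) = compose S5_S3 (?f g) (?f h)"
    proof (rule extensionalityI[where A = S5_S3])
      show "?f (g \<otimes>\<^bsub>T2\<^esub> h) \<in> extensional S5_S3"
        using bij[of "g \<otimes>\<^bsub>T2\<^esub> h"] gh by (simp add: Bij_def)
    qed (use gh in \<open>auto simp: compose_def torus_action_mult\<close>)
    then show "?f (g \<otimes>\<^bsub>T2\<^esub> h) = ?f g \<otimes>\<^bsub>BijGroup S5_S3\<^esub> ?f h"
      using bij gh by (simp add: BijGroup_def)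
  qed (simp add: bij BijGroup_def)
  then show ?thesis
    by (intro group_action.intro group_hom.intro group_hom_axioms.intro group_T2 group_BijGroup)
qed

end

theory Submission
  imports Defs
begin

text \<open>
  Each coordinate of \<open>S5_S3\<close> is rescaled by a character of the torus, so an element fixes a point
  exactly when the characters of all its nonvanishing coordinates are trivial there. A point has a
  nonvanishing coordinate in each of the two spheres, and the points with exactly one in each,
  such as the pairs of coordinate vectors, have the largest stabilizers. Freeness is therefore a condition on
  the six pairs consisting of a character \<open>(m, n)\<close> of the first sphere and a character \<open>(k, l)\<close> of
  the second: their common kernel has to be trivial. In terms of the character lattice, they have
  to generate \<open>\<int>\<^sup>2\<close>, which means that \<open>m l - n k\<close> is \<open>1\<close> or \<open>-1\<close>
  (\<open>characters_separate_torus_iff_det_unit\<close>, \<open>torus_action_free_iff\<close>).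

  An effectively free action makes all six common kernels equal. The kernel for the first coordinates
  is cut out by \<open>z\<^sup>m\<^sup>1 = 1\<close> and \<open>w\<^sup>l\<^sup>1 = 1\<close>; if all characters are trivial on it, then \<open>m1\<close> divides
  every exponent of \<open>z\<close> and \<open>l1\<close> every exponent of \<open>w\<close>. The gcd conditions thus force
  \<open>m1 = l1 = 1\<close>, this kernel is trivial, and the action is free. So both notions amount to the six
  determinants being units. Four of them are products of two nonnegative exponents and give
  \<open>m1 = m2 = m3 = l1 = l2 = 1\<close>, and the remaining two become \<open>1 - n2 k2\<close> and \<open>1 - n3 k2\<close>, which
  are units exactly when \<open>n2 k2\<close> and \<open>n3 k2\<close> lie in \<open>{0, 2}\<close>. Listing the factorizations of \<open>2\<close>
  yields the families and sporadic triples.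
\<close>

section \<open>Characters of the torus\<close>

text \<open>
  A character of the circle that is trivial on the \<open>m\<close>-th roots of unity is an \<open>m\<close>-th power. For
  \<open>m = 0\<close> this covers the fact that only the zero character is trivial on the whole circle.
\<close>

lemma dvd_if_roots_of_unity:
  fixes m k :: int
  assumes roots: "\<And>z::complex. norm z = 1 \<Longrightarrow> z powi m = 1 \<Longrightarrow> z powi k = 1"
  shows "m dvd k"
proof (cases "m = 0")
  case True
  show ?thesis
  proof (rule ccontr)
    assume "\<not> m dvd k"
    then have "k \<noteq> 0"
      by auto
    \<comment> \<open>Every point of the circle satisfies \<open>z powi 0 = 1\<close>, but this one has \<open>k\<close>-th power \<open>- 1\<close>.\<close>
    have "cis (pi / k) powi k = 1"
      using roots True by simp
    then show False
      using \<open>k \<noteq> 0\<close> by (simp add: cis_power_int)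
  qed
next
  case False
  have "cis (2 * pi / m) powi m = 1"
    using False by (simp add: cis_power_int)
  then have "cis (2 * pi / m) powi k = 1"
    by (intro roots) auto
  then have "cos (k * (2 * pi / m)) = 1"
    by (simp add: cis_power_int complex_eq_iff)
  then obtain j :: int where "k * (2 * pi / m) = j * 2 * pi"
    by (auto simp: cos_one_2pi_int)
  then have "real_of_int k = real_of_int (m * j)"
    using False by (simp add: field_simps)
  then show ?thesis
    by (simp only: of_int_eq_iff dvd_triv_left)
qed

text \<open>
  Cramer's rule in multiplicative form: \<open>p * s - q * r\<close> times either unit vector is an integer
  combination of \<open>(p, q)\<close> and \<open>(r, s)\<close>.
\<close>

lemma powi_mult_eq_one_imp_powi_det_eq_one:
  fixes z w :: complex and p q r s :: int
  assumes "z \<noteq> 0" "w \<noteq> 0" "z powi p * w powi q = 1" "z powi r * w powi s = 1"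
  shows "z powi (p * s - q * r) = 1" "w powi (p * s - q * r) = 1"
proof -
  have "z powi (p * s) * w powi (q * s) = (z powi p * w powi q) powi s"
    "z powi (q * r) * w powi (q * s) = (z powi r * w powi s) powi q"
    by (simp_all add: power_int_mult_distrib mult_ac flip: power_int_mult)
  then have "z powi (p * s) * w powi (q * s) = z powi (q * r) * w powi (q * s)"
    using assms(3,4) by simp
  then have "z powi (p * s) = z powi (q * r)"
    using assms(2) by simp
  then show "z powi (p * s - q * r) = 1"
    using assms(1) by (simp add: power_int_diff)
  have "z powi (p * r) * w powi (q * r) = (z powi p * w powi q) powi r"
    "z powi (p * r) * w powi (p * s) = (z powi r * w powi s) powi p"
    by (simp_all add: power_int_mult_distrib mult_ac flip: power_int_mult)
  then have "z powi (p * r) * w powi (p * s) = z powi (p * r) * w powi (q * r)"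
    using assms(3,4) by simp
  then have "w powi (p * s) = w powi (q * r)"
    using assms(1) by simp
  then show "w powi (p * s - q * r) = 1"
    using assms(2) by (simp add: power_int_diff)
qed

text \<open>
  Two characters generate the character lattice exactly when their common kernel is trivial. Instead
  of Pontryagin duality, the proof exhibits kernel elements: if \<open>u\<^sup>d = 1\<close> for the determinant
  \<open>d\<close>, then the columns of the adjugate matrix give the kernel elements \<open>(u\<^sup>s, u\<^sup>-\<^sup>r)\<close> and
  \<open>(u\<^sup>-\<^sup>q, u\<^sup>p)\<close>. Triviality makes \<open>d\<close> divide all four entries, so \<open>d\<^sup>2\<close> divides \<open>d\<close>; and \<open>d\<close> is
  nonzero, since otherwise all four entries would vanish.
\<close>

lemma characters_separate_torus_iff_det_unit:
  fixes p q r s :: int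
  shows "(\<forall>z w::complex. norm z = 1 \<and> norm w = 1 \<and>
            z powi p * w powi q = 1 \<and> z powi r * w powi s = 1 \<longrightarrow> z = 1 \<and> w = 1)
         \<longleftrightarrow> p * s - q * r dvd 1"
    (is "?separate \<longleftrightarrow> ?d dvd 1")
proof
  assume sep: ?separate
  have sr: "u powi s = 1 \<and> u powi (- r) = 1" if "norm u = 1" "u powi ?d = 1" for u :: complex
  proof -
    have "u \<noteq> 0" using that by auto
    have "(u powi s) powi p * (u powi (- r)) powi q = u powi ?d"
      using \<open>u \<noteq> 0\<close> by (simp add: algebra_simps flip: power_int_mult power_int_add)
    moreover have "(u powi s) powi r * (u powi (- r)) powi s = 1"
      using \<open>u \<noteq> 0\<close> by (simp add: algebra_simps flip: power_int_mult power_int_add)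
    ultimately show ?thesis
      using that by (intro sep[rule_format]) (simp add: norm_power_int)
  qed
  have qp: "u powi (- q) = 1 \<and> u powi p = 1" if "norm u = 1" "u powi ?d = 1" for u :: complex
  proof -
    have "u \<noteq> 0" using that by auto
    have "(u powi (- q)) powi r * (u powi p) powi s = u powi ?d"
      using \<open>u \<noteq> 0\<close> by (simp add: algebra_simps flip: power_int_mult power_int_add)
    moreover have "(u powi (- q)) powi p * (u powi p) powi q = 1"
      using \<open>u \<noteq> 0\<close> by (simp add: algebra_simps flip: power_int_mult power_int_add)
    ultimately show ?thesis
      using that by (intro sep[rule_format]) (simp add: norm_power_int)
  qed
  have "?d dvd s" "?d dvd - r" "?d dvd - q" "?d dvd p"
    using sr qp by (blast intro: dvd_if_roots_of_unity)+
  then have dvd: "?d dvd p" "?d dvd q" "?d dvd r" "?d dvd s"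
    by simp_all
  have "?d \<noteq> 0"
  proof
    assume "?d = 0"
    then have "p = 0" "q = 0" "r = 0" "s = 0"
      using dvd unfolding \<open>?d = 0\<close> by simp_all
    \<comment> \<open>Two trivial characters have the whole torus as common kernel.\<close>
    then show False
      using sep[rule_format, of "- 1" 1] by simp
  qed
  have "?d * ?d dvd ?d * 1"
    using dvd by (simp add: mult_dvd_mono dvd_diff)
  then show "?d dvd 1"
    using \<open>?d \<noteq> 0\<close> by (simp only: dvd_mult_cancel_left) simp
next
  assume unit: "?d dvd 1"
  show ?separate
  proof (intro allI impI)
    fix z w :: complex
    assume *: "norm z = 1 \<and> norm w = 1 \<and> z powi p * w powi q = 1 \<and> z powi r * w powi s = 1"
    then have "z powi ?d = 1" "w powi ?d = 1"
      by (intro powi_mult_eq_one_imp_powi_det_eq_one; force)+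
    moreover have "?d = 1 \<or> ?d = - 1"
      using unit by auto
    ultimately show "z = 1 \<and> w = 1"
      by (auto simp: power_int_minus)
  qed
qed

section \<open>Stabilizers\<close>

text \<open>
  The vectors \<open>(m1, m2, m3)\<close>, \<open>(0, n2, n3)\<close> and \<open>(0, k2)\<close>, \<open>(l1, l2)\<close> collect the exponents of
  \<open>z\<close> and \<open>w\<close> on the two spheres. The explicit zeros let all coordinates be treated uniformly.
\<close>

lemma torus_action_fixes_iff:
  assumes "(a, b) \<in> S5_S3"
  shows "torus_action m1 m2 m3 n2 n3 k2 l1 l2 (z, w) (a, b) = (a, b) \<longleftrightarrow>
    (\<forall>i. a $ i \<noteq> 0 \<longrightarrow>
        z powi (vector [m1, m2, m3] :: int^3) $ i * w powi (vector [0, n2, n3] :: int^3) $ i = 1) \<and>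
    (\<forall>j. b $ j \<noteq> 0 \<longrightarrow>
        z powi (vector [0, k2] :: int^2) $ j * w powi (vector [l1, l2] :: int^2) $ j = 1)"
  using assms by (auto simp: torus_action_def vec_eq_iff forall_3 forall_2)

lemma axis_in_S5_S3: "(axis i 1, axis j 1) \<in> S5_S3"
  by (simp add: S5_S3_def)

lemma torus_action_fixes_axis_iff:
  "torus_action m1 m2 m3 n2 n3 k2 l1 l2 (z, w) (axis i 1, axis j 1) = (axis i 1, axis j 1) \<longleftrightarrow>
    z powi (vector [m1, m2, m3] :: int^3) $ i * w powi (vector [0, n2, n3] :: int^3) $ i = 1 \<and>
    z powi (vector [0, k2] :: int^2) $ j * w powi (vector [l1, l2] :: int^2) $ j = 1"
  unfolding torus_action_fixes_iff[OF axis_in_S5_S3] by (simp add: axis_def)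

text \<open>
  The stabilizer of any point is contained in that of a pair of coordinate vectors, so only the
  common kernels of one character from each sphere matter.
\<close>

lemma torus_action_free_iff:
  "free_action T2 S5_S3 (torus_action m1 m2 m3 n2 n3 k2 l1 l2) \<longleftrightarrow>
    (\<forall>i j. (vector [m1, m2, m3] :: int^3) $ i * (vector [l1, l2] :: int^2) $ j
         - (vector [0, n2, n3] :: int^3) $ i * (vector [0, k2] :: int^2) $ j dvd 1)"
    (is "free_action T2 S5_S3 ?\<phi> \<longleftrightarrow> (\<forall>i j. ?m $ i * ?l $ j - ?n $ i * ?k $ j dvd 1)")
proof -
  have "free_action T2 S5_S3 ?\<phi> \<longleftrightarrow>
    (\<forall>i j. \<forall>z w::complex. norm z = 1 \<and> norm w = 1 \<and>
        z powi (?m $ i) * w powi (?n $ i) = 1 \<and> z powi (?k $ j) * w powi (?l $ j) = 1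
        \<longrightarrow> z = 1 \<and> w = 1)" (is "_ \<longleftrightarrow> ?coordinatewise")
  proof
    assume free: "free_action T2 S5_S3 ?\<phi>"
    show ?coordinatewise
    proof (intro allI impI)
      fix i j and z w :: complex
      assume *: "norm z = 1 \<and> norm w = 1 \<and>
        z powi (?m $ i) * w powi (?n $ i) = 1 \<and> z powi (?k $ j) * w powi (?l $ j) = 1"
      then have "?\<phi> (z, w) (axis i 1, axis j 1) = (axis i 1, axis j 1)"
        by (simp add: torus_action_fixes_axis_iff)
      then have "(z, w) = \<one>\<^bsub>T2\<^esub>"
        using free * axis_in_S5_S3[of i j] by (auto simp: free_action_def carrier_T2)
      then show "z = 1 \<and> w = 1"
        by (simp add: T2_def circle_group_def)
    qed
  next
    assume coord: ?coordinatewise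
    show "free_action T2 S5_S3 ?\<phi>"
      unfolding free_action_def
    proof (intro ballI impI)
      fix g assume g: "g \<in> carrier T2" and "\<exists>x\<in>S5_S3. ?\<phi> g x = x"
      then obtain z w a b where zw: "g = (z, w)" "norm z = 1" "norm w = 1"
        and ab: "(a, b) \<in> S5_S3" "?\<phi> (z, w) (a, b) = (a, b)"
        by (auto simp: carrier_T2)
      have "a \<noteq> 0" "b \<noteq> 0"
        using ab(1) by (auto simp: S5_S3_def)
      then obtain i j where "a $ i \<noteq> 0" "b $ j \<noteq> 0"
        by (auto simp: vec_eq_iff)
      then have "z powi (?m $ i) * w powi (?n $ i) = 1 \<and> z powi (?k $ j) * w powi (?l $ j) = 1"
        using ab(2) unfolding torus_action_fixes_iff[OF ab(1)] by blast
      then have "z = 1 \<and> w = 1"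
        by (intro coord[rule_format]) (simp add: zw)
      then show "g = \<one>\<^bsub>T2\<^esub>"
        by (simp add: zw T2_def circle_group_def)
    qed
  qed
  then show ?thesis
    by (simp only: characters_separate_torus_iff_det_unit)
qed

lemma free_imp_effectively_free_torus_action:
  assumes "free_action T2 S5_S3 (torus_action m1 m2 m3 n2 n3 k2 l1 l2)"
  shows "effectively_free_action T2 S5_S3 (torus_action m1 m2 m3 n2 n3 k2 l1 l2)"
  using assms torus_action_one unfolding free_action_def effectively_free_action_def by metis

text \<open>
  The stabilizer of the pair of first coordinate vectors consists of the pairs of an \<open>m1\<close>-th and an
  \<open>l1\<close>-th root of unity. Effective freeness puts it into the kernel of every character; testing
  with \<open>w = 1\<close> and with \<open>z = 1\<close> gives the two divisibilities.
\<close>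

lemma effectively_free_imp_dvd:
  assumes eff: "effectively_free_action T2 S5_S3 (torus_action m1 m2 m3 n2 n3 k2 l1 l2)"
  shows "m1 dvd Gcd {m1, m2, m3, k2}" "l1 dvd Gcd {n2, n3, l1, l2}"
proof -
  have trivial: "z powi m2 * w powi n2 = 1 \<and> z powi m3 * w powi n3 = 1 \<and> z powi k2 * w powi l2 = 1"
    if "norm z = 1" "norm w = 1" "z powi m1 = 1" "w powi l1 = 1" for z w :: complex
  proof -
    have "torus_action m1 m2 m3 n2 n3 k2 l1 l2 (z, w) (axis 1 1, axis 1 1) = (axis 1 1, axis 1 1)"
      using that by (simp add: torus_action_fixes_axis_iff)
    then have "torus_action m1 m2 m3 n2 n3 k2 l1 l2 (z, w) (axis i 1, axis j 1) =
        (axis i 1, axis j 1)" for i j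
      using bspec[OF eff[unfolded effectively_free_action_def], of "(z, w)"] that(1,2)
        axis_in_S5_S3[of 1 1] axis_in_S5_S3[of i j]
      by (auto simp: carrier_T2)
    from this[of 2 2] this[of 3 2] show ?thesis
      by (simp add: torus_action_fixes_axis_iff)
  qed
  have "m1 dvd m2" "m1 dvd m3" "m1 dvd k2"
    using trivial[where w = 1] by (auto intro: dvd_if_roots_of_unity)
  then show "m1 dvd Gcd {m1, m2, m3, k2}"
    by simp
  have "l1 dvd n2" "l1 dvd n3" "l1 dvd l2"
    using trivial[where z = 1] by (auto intro: dvd_if_roots_of_unity)
  then show "l1 dvd Gcd {n2, n3, l1, l2}"
    by simp
qed

text \<open>
  An element with a fixed point fixes everything, in particular the pair of first coordinate vectors,
  whose stabilizer is trivial when \<open>m1\<close> and \<open>l1\<close> are units.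
\<close>

lemma effectively_free_imp_free_torus_action:
  assumes eff: "effectively_free_action T2 S5_S3 (torus_action m1 m2 m3 n2 n3 k2 l1 l2)"
    and "m1 dvd 1" "l1 dvd 1"
  shows "free_action T2 S5_S3 (torus_action m1 m2 m3 n2 n3 k2 l1 l2)"
  unfolding free_action_def
proof (intro ballI impI)
  fix g assume g: "g \<in> carrier T2"
    and "\<exists>x\<in>S5_S3. torus_action m1 m2 m3 n2 n3 k2 l1 l2 g x = x"
  then have fixed: "torus_action m1 m2 m3 n2 n3 k2 l1 l2 g (axis 1 1, axis 1 1) =
      (axis 1 1, axis 1 1)"
    using bspec[OF eff[unfolded effectively_free_action_def] g] axis_in_S5_S3[of 1 1] by blast
  obtain z w where zw: "g = (z, w)" "norm z = 1" "norm w = 1"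
    using g by (auto simp: carrier_T2)
  have "z powi m1 = 1" "w powi l1 = 1"
    using fixed by (simp_all add: zw torus_action_fixes_axis_iff)
  moreover have "m1 = 1 \<or> m1 = - 1" "l1 = 1 \<or> l1 = - 1"
    using assms(2,3) by auto
  ultimately have "z = 1" "w = 1"
    by (auto simp: power_int_minus)
  then show "g = \<one>\<^bsub>T2\<^esub>"
    by (simp add: zw T2_def circle_group_def)
qed

section \<open>The classification\<close>

lemma one_minus_mult_dvd_one_iff:
  fixes n k :: int
  assumes "k \<ge> 0"
  shows "1 - n * k dvd 1 \<longleftrightarrow> k = 0 \<or> n = 0 \<or> (n = 2 \<and> k = 1) \<or> (n = 1 \<and> k = 2)"
proof
  assume "1 - n * k dvd 1"
  then have "\<bar>1 - n * k\<bar> = 1"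
    by simp
  then have prod: "n * k = 0 \<or> n * k = 2"
    by arith
  show "k = 0 \<or> n = 0 \<or> (n = 2 \<and> k = 1) \<or> (n = 1 \<and> k = 2)"
  proof (cases "n * k = 0")
    case False
    then have "n * k = 2" using prod by blast
    then have "k dvd 2" by (metis dvd_triv_right)
    then have "k \<le> 2" by (rule zdvd_imp_le) simp
    then have "k = 0 \<or> k = 1 \<or> k = 2" using assms by linarith
    then show ?thesis using \<open>n * k = 2\<close> by auto
  qed auto
qed auto

theorem proposition4p15:
  fixes m1 m2 m3 n2 n3 k2 l1 l2 :: int
  assumes "Gcd {m1, m2, m3, k2} = 1"
    and "Gcd {n2, n3, l1, l2} = 1"
    and "m1 \<ge> 0" and "m2 \<ge> 0" and "m3 \<ge> 0"
    and "l1 \<ge> 0" and "l2 \<ge> 0" and "k2 \<ge> 0"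
  defines "\<phi> \<equiv> torus_action m1 m2 m3 n2 n3 k2 l1 l2"
    and "A \<equiv> {(0, 0, k) | k. True} \<union> {(p, q, 0) | p q. True} \<union>
              {(1, 1, 2), (2, 2, 1), (0, 2, 1), (0, 1, 2)} :: (int \<times> int \<times> int) set"
  shows "(effectively_free_action T2 S5_S3 \<phi> \<longleftrightarrow>
            m1 = 1 \<and> m2 = 1 \<and> m3 = 1 \<and> l1 = 1 \<and> l2 = 1 \<and>
            ((n2, n3, k2) \<in> A \<or> (n3, n2, k2) \<in> A)) \<and>
         (effectively_free_action T2 S5_S3 \<phi> \<longleftrightarrow> free_action T2 S5_S3 \<phi>)"
proof -
  have eff_iff_free: "effectively_free_action T2 S5_S3 \<phi> \<longleftrightarrow> free_action T2 S5_S3 \<phi>"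
    using effectively_free_imp_dvd effectively_free_imp_free_torus_action
      free_imp_effectively_free_torus_action assms(1,2)
    unfolding \<phi>_def by metis
  \<comment> \<open>The determinants of the pairs of weights; in four of the six the term \<open>n k\<close> vanishes.\<close>
  have "free_action T2 S5_S3 \<phi> \<longleftrightarrow>
      m1 * l1 dvd 1 \<and> m1 * l2 dvd 1 \<and> m2 * l1 dvd 1 \<and> m3 * l1 dvd 1 \<and>
      m2 * l2 - n2 * k2 dvd 1 \<and> m3 * l2 - n3 * k2 dvd 1"
    unfolding \<phi>_def torus_action_free_iff forall_3 forall_2 by (auto simp: algebra_simps)
  also have "\<dots> \<longleftrightarrow> m1 = 1 \<and> m2 = 1 \<and> m3 = 1 \<and> l1 = 1 \<and> l2 = 1 \<and>
      1 - n2 * k2 dvd 1 \<and> 1 - n3 * k2 dvd 1"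
    using assms(3-8) by (auto simp: zmult_eq_1_iff)
  also have "\<dots> \<longleftrightarrow> m1 = 1 \<and> m2 = 1 \<and> m3 = 1 \<and> l1 = 1 \<and> l2 = 1 \<and>
      ((n2, n3, k2) \<in> A \<or> (n3, n2, k2) \<in> A)"
    unfolding one_minus_mult_dvd_one_iff[OF \<open>k2 \<ge> 0\<close>] A_def by auto
  finally show ?thesis
    using eff_iff_free by blast
qed

end
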